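(* In the group-sparsity setting described in the context, let $A:X=\mathbf{R}^n\to\mathbf{R}^m$ be a linear map (identified with an $m\times n$ matrix), let $\phi(\cdot)$ be a norm on $\mathbf{R}^m$, and let $s>0$. Given $\gamma>0$, let an $m\times N$ matrix $H$ and an $N\times N$ matrix $W$ satisfy the relations $$(a)\ \ B=WB+H^TA,\qquad (b)\ \ \max_{\ell\le K}\pi_s\left(\mathrm{Col}_\ell(\Omega[W])\right)\le\gamma,$$ where $\mathrm{Col}_j(Q)$ is the $j$-th column of a matrix $Q$. Then $$\forall z\in X:\quad \|Bz\|_{1,s}\le\beta\phi(Az)+\gamma\|Bz\|$$ holds true with $$\beta=\beta[H]:=\max_{v\in\mathbf{R}^m}\left\{\|H^Tv\|_{1,s}:\phi(v)\le1\right\}.$$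
   Context: Group-sparsity setting. $X=\mathbf{R}^n$ with coordinates indexed by $V=\{1,\dots,n\}$; $V=V_1\cup\dots\cup V_K$ with nonempty, possibly overlapping subsets $V_\ell$ of cardinalities $n_\ell$; $\mathbf{R}(V_\ell)$ is the space of real vectors with entries indexed by $V_\ell$; for $x\in X$, $x^\ell\in\mathbf{R}(V_\ell)$ is the natural projection (restriction) of $x$ to the indices in $V_\ell$. Each $V_\ell$ is assigned a weight $\chi_\ell>0$ and each $\mathbf{R}(V_\ell)$ is equipped with a norm $\|\cdot\|_{(\ell)}$. $E=\mathbf{R}(V_1)\times\dots\times\mathbf{R}(V_K)$, of dimension $N=n_1+\dots+n_K$, is identified with $\mathbf{R}^N=\mathbf{R}^{n_1}\times\dots\times\mathbf{R}^{n_K}$; its elements are $w=[w^1;\dots;w^K]$. $Bx=[x^1;\dots;x^K]$ ($B$ is identified with an $N\times n$ matrix). The norm on $E$ is $\|w\|=\sum_{\ell=1}^K\|w^\ell\|_{(\ell)}$. For $u\in\mathbf{R}^K$, $\pi_s(u)=2\max_\eta\{\sum_{\ell=1}^K\eta_\ell|u_\ell|:\eta_\ell\in\{0,1\}\ \forall\ell,\ \sum_{\ell=1}^K\chi_\ell\eta_\ell\le s\}$, and for $w\in E$, $\|w\|_{1,s}=\pi_s([\|w^1\|_{(1)};\dots;\|w^K\|_{(K)}])$. For an $N\times N$ matrix $W$, $W^{k\ell}$ denotes the $n_k\times n_\ell$ block of $W$ associated with the decomposition $\mathbf{R}^N=\mathbf{R}^{n_1}\times\dots\times\mathbf{R}^{n_K}$,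 and $\Omega[W]$ is the $K\times K$ matrix with entries $\Omega_{k\ell}=\|W^{k\ell}\|_{(\ell k)}$, where for a linear map $Q^{k\ell}:\mathbf{R}(V_\ell)\to\mathbf{R}(V_k)$, $\|Q^{k\ell}\|_{(\ell k)}=\max_u\{\|Q^{k\ell}u\|_{(k)}:\|u\|_{(\ell)}\le1\}$. *)

theory Defs
  imports "HOL-Analysis.Analysis"
begin

definition is_norm_on :: "'a::real_vector set \<Rightarrow> ('a \<Rightarrow> real) \<Rightarrow> bool" where
  "is_norm_on S f \<longleftrightarrow>
     (\<forall>x\<in>S. 0 \<le> f x) \<and>
     (\<forall>x\<in>S. f x = 0 \<longleftrightarrow> x = 0) \<and>
     (\<forall>c. \<forall>x\<in>S. f (c *\<^sub>R x) = \<bar>c\<bar> * f x) \<and>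
     (\<forall>x\<in>S. \<forall>y\<in>S. f (x + y) \<le> f x + f y)"

text \<open>
  Vectors with entries indexed by a subset \<open>U\<close> of the coordinates are represented
  as vectors padded with zeros outside \<open>U\<close>, so that they form a subspace of the
  ambient coordinate space.
\<close>

definition vecs_on :: "'n::finite set \<Rightarrow> (real^'n) set" where
  "vecs_on U = {u. \<forall>i. i \<notin> U \<longrightarrow> u $ i = 0}"

definition restr :: "'n::finite set \<Rightarrow> real^'n \<Rightarrow> real^'n" where
  "restr U x = (\<chi> i. if i \<in> U then x $ i else 0)"

text \<open>
  The product \<open>E\<close> of the spaces \<open>vecs_on (V l)\<close> is identified with \<open>real^'p\<close> by a labelling
  \<open>e\<close>, a bijection from \<open>'p\<close> onto \<open>SIGMA l:UNIV. V l\<close>: the coordinate \<open>p\<close> with \<open>e p = (l, i)\<close>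
  holds the entry with index \<open>i\<close> of the \<open>l\<close>-th component. In particular
  \<open>CARD('p) = (\<Sum>l\<in>UNIV. card (V l))\<close>.
\<close>

definition comp_of ::
  "('p::finite \<Rightarrow> 'k \<times> 'n::finite) \<Rightarrow> ('k \<Rightarrow> 'n set) \<Rightarrow> 'k \<Rightarrow> real^'p \<Rightarrow> real^'n" where
  "comp_of e V l w = (\<chi> i. if i \<in> V l then w $ inv e (l, i) else 0)"

definition stack ::
  "('p::finite \<Rightarrow> 'k \<times> 'n::finite) \<Rightarrow> ('k \<Rightarrow> real^'n) \<Rightarrow> real^'p" where
  "stack e ws = (\<chi> p. ws (fst (e p)) $ snd (e p))"

definition B_map ::
  "('p::finite \<Rightarrow> 'k \<times> 'n::finite) \<Rightarrow> ('k \<Rightarrow> 'n set) \<Rightarrow> real^'n \<Rightarrow> real^'p" where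
  "B_map e V x = stack e (\<lambda>l. restr (V l) x)"

definition group_norms ::
  "('p::finite \<Rightarrow> 'k::finite \<times> 'n::finite) \<Rightarrow> ('k \<Rightarrow> 'n set) \<Rightarrow> ('k \<Rightarrow> real^'n \<Rightarrow> real)
     \<Rightarrow> real^'p \<Rightarrow> real^'k" where
  "group_norms e V nrm w = (\<chi> l. nrm l (comp_of e V l w))"

definition E_norm ::
  "('p::finite \<Rightarrow> 'k::finite \<times> 'n::finite) \<Rightarrow> ('k \<Rightarrow> 'n set) \<Rightarrow> ('k \<Rightarrow> real^'n \<Rightarrow> real)
     \<Rightarrow> real^'p \<Rightarrow> real" where
  "E_norm e V nrm w = (\<Sum>l\<in>UNIV. nrm l (comp_of e V l w))"

text \<open>The set below is finite, and nonempty for \<open>s \<ge> 0\<close> (take \<open>\<eta> = 0\<close>).\<close>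

definition pi_s :: "('k::finite \<Rightarrow> real) \<Rightarrow> real \<Rightarrow> real^'k \<Rightarrow> real" where
  "pi_s wt s u = 2 * Max {(\<Sum>l\<in>UNIV. \<eta> $ l * \<bar>u $ l\<bar>) | \<eta> :: real^'k.
     (\<forall>l. \<eta> $ l \<in> {0, 1}) \<and> (\<Sum>l\<in>UNIV. wt l * \<eta> $ l) \<le> s}"

definition norm_1s ::
  "('p::finite \<Rightarrow> 'k::finite \<times> 'n::finite) \<Rightarrow> ('k \<Rightarrow> 'n set) \<Rightarrow> ('k \<Rightarrow> real^'n \<Rightarrow> real)
     \<Rightarrow> ('k \<Rightarrow> real) \<Rightarrow> real \<Rightarrow> real^'p \<Rightarrow> real" where
  "norm_1s e V nrm wt s w = pi_s wt s (group_norms e V nrm w)"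

text \<open>
  The \<open>(k, l)\<close> block of \<open>W\<close>, with rows indexed by \<open>V k\<close> and columns by \<open>V l\<close>, padded with
  zeros like the vectors it acts on.
\<close>

definition block ::
  "('p::finite \<Rightarrow> 'k \<times> 'n::finite) \<Rightarrow> ('k \<Rightarrow> 'n set) \<Rightarrow> real^'p^'p \<Rightarrow> 'k \<Rightarrow> 'k \<Rightarrow> real^'n^'n" where
  "block e V W k l =
     (\<chi> i j. if i \<in> V k \<and> j \<in> V l then W $ inv e (k, i) $ inv e (l, j) else 0)"

text \<open>The supremum is a maximum, the unit ball of \<open>nrm l\<close> in \<open>vecs_on (V l)\<close> being compact.\<close>

definition block_norm ::
  "('k \<Rightarrow> 'n::finite set) \<Rightarrow> ('k \<Rightarrow> real^'n \<Rightarrow> real) \<Rightarrow> 'k \<Rightarrow> 'k \<Rightarrow> real^'n^'n \<Rightarrow> real" where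
  "block_norm V nrm k l Q = (SUP u\<in>{u \<in> vecs_on (V l). nrm l u \<le> 1}. nrm k (Q *v u))"

definition Omega ::
  "('p::finite \<Rightarrow> 'k::finite \<times> 'n::finite) \<Rightarrow> ('k \<Rightarrow> 'n set) \<Rightarrow> ('k \<Rightarrow> real^'n \<Rightarrow> real)
     \<Rightarrow> real^'p^'p \<Rightarrow> real^'k^'k" where
  "Omega e V nrm W = (\<chi> k l. block_norm V nrm k l (block e V W k l))"

text \<open>Again the supremum is a maximum, by compactness of the unit ball of \<open>\<phi>\<close>.\<close>

definition beta ::
  "('p::finite \<Rightarrow> 'k::finite \<times> 'n::finite) \<Rightarrow> ('k \<Rightarrow> 'n set) \<Rightarrow> ('k \<Rightarrow> real^'n \<Rightarrow> real)
     \<Rightarrow> ('k \<Rightarrow> real) \<Rightarrow> real \<Rightarrow> (real^'m \<Rightarrow> real) \<Rightarrow> real^'p^'m::finite \<Rightarrow> real" where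
  "beta e V nrm wt s \<phi> H = (SUP v\<in>{v. \<phi> v \<le> 1}. norm_1s e V nrm wt s (transpose H *v v))"

lemma comp_of_stack:
  assumes "bij_betw e UNIV (SIGMA l:UNIV. V l)" and "ws l \<in> vecs_on (V l)"
  shows "comp_of e V l (stack e ws) = ws l"
proof -
  have "e (inv e (l, i)) = (l, i)" if "i \<in> V l" for i
    using assms(1) that by (intro f_inv_into_f) (auto simp: bij_betw_def)
  then show ?thesis
    using assms(2) by (auto simp: comp_of_def stack_def vecs_on_def vec_eq_iff)
qed

lemma comp_of_B_map:
  assumes "bij_betw e UNIV (SIGMA l:UNIV. V l)"
  shows "comp_of e V l (B_map e V x) = restr (V l) x"
  unfolding B_map_def by (rule comp_of_stack[OF assms]) (simp add: vecs_on_def restr_def)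

lemma linear_B_map: "linear (B_map e V)"
  by (rule linearI) (auto simp: B_map_def stack_def restr_def vec_eq_iff)

lemma comp_of_mult:
  fixes W :: "real^'p::finite^'p" and V :: "'k::finite \<Rightarrow> 'n::finite set"
  assumes "bij_betw e UNIV (SIGMA l:UNIV. V l)"
  shows "comp_of e V k (W *v w) = (\<Sum>l\<in>UNIV. block e V W k l *v comp_of e V l w)"
proof -
  have inj: "inj e" and rng: "range e = (SIGMA l:UNIV. V l)"
    using assms by (auto simp: bij_betw_def)
  have reindex: "(\<Sum>p\<in>UNIV. f p) = (\<Sum>l\<in>UNIV. \<Sum>j\<in>V l. f (inv e (l, j)))" for f :: "'p \<Rightarrow> real"
  proof -
    have "(\<Sum>l\<in>UNIV. \<Sum>j\<in>V l. f (inv e (l, j))) = (\<Sum>q\<in>range e. f (inv e q))"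
      unfolding rng by (subst sum.Sigma) (auto simp: split_def)
    also have "\<dots> = (\<Sum>p\<in>UNIV. f p)"
      using inj by (subst sum.reindex) auto
    finally show ?thesis by simp
  qed
  have "(\<Sum>j\<in>UNIV. block e V W k l $ i $ j * comp_of e V l w $ j)
      = (\<Sum>j\<in>V l. W $ inv e (k, i) $ inv e (l, j) * w $ inv e (l, j))" if "i \<in> V k" for i l
    using that by (intro sum.mono_neutral_cong_right) (auto simp: block_def comp_of_def)
  moreover have "(\<Sum>j\<in>UNIV. block e V W k l $ i $ j * comp_of e V l w $ j) = 0" if "i \<notin> V k" for i l
    using that by (simp add: block_def)
  ultimately show ?thesis
    by (auto simp: vec_eq_iff comp_of_def[of e V k] matrix_vector_mult_def reindex)
qed

end

theory Submission
  imports Defs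
begin

text \<open>
  Split \<open>B z = W (B z) + H\<^sup>T (A z)\<close> and use the triangle inequality for \<open>norm_1s\<close>. The second
  term is at most \<open>\<beta> \<phi> (A z)\<close> by homogeneity. For the first one, the vector of group norms of
  \<open>W w\<close> is dominated entrywise by the combination of the columns of \<open>\<Omega>[W]\<close> with the nonnegative
  coefficients \<open>\<parallel>w\<^sup>l\<parallel>\<close>, and \<open>pi_s\<close> is monotone and sublinear, so it is at most
  \<open>\<gamma> \<Sum>\<^sub>l \<parallel>w\<^sup>l\<parallel>\<close>. That the suprema are not junk values follows from the equivalence of norms
  in finite dimension.
\<close>

section \<open>Norms on subspaces\<close>

lemma
  assumes "is_norm_on S f"
  shows is_norm_on_nonneg: "x \<in> S \<Longrightarrow> 0 \<le> f x"
    and is_norm_on_eq_0: "x \<in> S \<Longrightarrow> f x = 0 \<longleftrightarrow> x = 0"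
    and is_norm_on_scale: "x \<in> S \<Longrightarrow> f (c *\<^sub>R x) = \<bar>c\<bar> * f x"
    and is_norm_on_triangle: "x \<in> S \<Longrightarrow> y \<in> S \<Longrightarrow> f (x + y) \<le> f x + f y"
  using assms by (simp_all add: is_norm_on_def)

lemma is_norm_on_sum:
  assumes f: "is_norm_on S f" and S: "subspace S" and "finite I" and "\<And>i. i \<in> I \<Longrightarrow> g i \<in> S"
  shows "f (\<Sum>i\<in>I. g i) \<le> (\<Sum>i\<in>I. f (g i))"
  using assms(3,4)
proof (induction I rule: finite_induct)
  case empty
  then show ?case
    using is_norm_on_eq_0[OF f, of 0] subspace_0[OF S] by simp
next
  case (insert i I)
  have "f (g i + (\<Sum>j\<in>I. g j)) \<le> f (g i) + f (\<Sum>j\<in>I. g j)"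
    using insert.prems by (intro is_norm_on_triangle[OF f] subspace_sum[OF S]) auto
  also have "\<dots> \<le> f (g i) + (\<Sum>j\<in>I. f (g j))"
    using insert by (intro add_left_mono) auto
  finally show ?case
    using insert.hyps by simp
qed

text \<open>In an orthonormal basis of \<open>S\<close> the coefficients of \<open>x\<close> are at
  most \<open>norm x\<close> by Cauchy-Schwarz, so the sum of \<open>f\<close> over the basis serves
  as \<open>C\<close>. The basis is taken inside \<open>S\<close> because \<open>f\<close> is
  controlled only there.\<close>

lemma is_norm_on_le_norm:
  fixes S :: "'a::euclidean_space set"
  assumes f: "is_norm_on S f" and S: "subspace S"
  obtains C where "0 \<le> C" and "\<And>x. x \<in> S \<Longrightarrow> f x \<le> C * norm x"
proof -
  obtain B where BS: "B \<subseteq> S" and orth: "pairwise orthogonal B"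
    and B1: "\<And>b. b \<in> B \<Longrightarrow> norm b = 1" and indep: "independent B" and span: "span B = S"
    using orthonormal_basis_subspace[OF S] by metis
  have fin: "finite B"
    using indep by (rule independent_imp_finite)
  show ?thesis
  proof
    show "0 \<le> (\<Sum>b\<in>B. f b)"
      using BS by (intro sum_nonneg is_norm_on_nonneg[OF f]) auto
    fix x assume x: "x \<in> S"
    have "x = (\<Sum>b\<in>B. (x \<bullet> b) *\<^sub>R b)"
      using orthonormal_basis_expand[OF orth B1, of x] x span fin by simp
    then have "f x = f (\<Sum>b\<in>B. (x \<bullet> b) *\<^sub>R b)"
      by simp
    also have "\<dots> \<le> (\<Sum>b\<in>B. f ((x \<bullet> b) *\<^sub>R b))"
      using BS by (intro is_norm_on_sum[OF f S fin] subspace_scale[OF S]) auto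
    also have "\<dots> = (\<Sum>b\<in>B. \<bar>x \<bullet> b\<bar> * f b)"
      using BS by (intro sum.cong refl is_norm_on_scale[OF f]) auto
    also have "\<dots> \<le> (\<Sum>b\<in>B. norm x * f b)"
    proof (intro sum_mono mult_right_mono)
      fix b assume b: "b \<in> B"
      show "\<bar>x \<bullet> b\<bar> \<le> norm x"
        using Cauchy_Schwarz_ineq2[of x b] B1[OF b] by simp
      show "0 \<le> f b"
        using b BS by (intro is_norm_on_nonneg[OF f]) auto
    qed
    also have "\<dots> = (\<Sum>b\<in>B. f b) * norm x"
      by (simp add: sum_distrib_left mult.commute)
    finally show "f x \<le> (\<Sum>b\<in>B. f b) * norm x" .
  qed
qed

lemma continuous_on_is_norm_on:
  fixes S :: "'a::euclidean_space set"
  assumes f: "is_norm_on S f" and S: "subspace S"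
  shows "continuous_on S f"
proof -
  obtain C where C: "0 \<le> C" "\<And>x. x \<in> S \<Longrightarrow> f x \<le> C * norm x"
    using is_norm_on_le_norm[OF f S] by metis
  \<comment> \<open>Exchanging \<open>x\<close> and \<open>y\<close> turns this one-sided bound into
    a Lipschitz estimate with constant \<open>C\<close>.\<close>
  have le: "f x - f y \<le> C * norm (x - y)" if "x \<in> S" "y \<in> S" for x y
  proof -
    have "f (y + (x - y)) \<le> f y + f (x - y)"
      using that by (intro is_norm_on_triangle[OF f] subspace_diff[OF S])
    then show ?thesis
      using C(2)[OF subspace_diff[OF S that]] by simp
  qed
  have "C-lipschitz_on S f"
    using le C(1) by (intro lipschitz_onI) (fastforce simp: dist_norm abs_le_iff norm_minus_commute)+
  then show ?thesis
    by (rule lipschitz_on_continuous_on)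
qed

text \<open>The unit sphere of \<open>S\<close> is compact, so the continuous \<open>f\<close>
  attains a minimum on it, positive by definiteness. Its reciprocal is \<open>D\<close>, and scaling
  carries the bound to all of \<open>S\<close>.\<close>

lemma norm_le_is_norm_on:
  fixes S :: "'a::euclidean_space set"
  assumes f: "is_norm_on S f" and S: "subspace S"
  obtains D where "0 \<le> D" and "\<And>x. x \<in> S \<Longrightarrow> norm x \<le> D * f x"
proof (cases "S \<subseteq> {0}")
  case True
  \<comment> \<open>The unit sphere of a trivial subspace is empty, so there is no minimum to take;
    \<open>D = 0\<close> works instead.\<close>
  with that[of 0] show ?thesis by auto
next
  case False
  then obtain a where a: "a \<in> S" "a \<noteq> 0" by blast
  have "a /\<^sub>R norm a \<in> S \<inter> sphere 0 1"
    using a subspace_scale[OF S] by simp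
  then have ne: "S \<inter> sphere 0 1 \<noteq> {}" by blast
  have "compact (S \<inter> sphere 0 1)"
    using closed_subspace[OF S] by (simp add: closed_Int_compact)
  then obtain y where y: "y \<in> S" "norm y = 1" and min: "\<And>x. x \<in> S \<Longrightarrow> norm x = 1 \<Longrightarrow> f y \<le> f x"
    using continuous_attains_inf[OF _ ne, of f]
      continuous_on_subset[OF continuous_on_is_norm_on[OF f S]] by auto
  have pos: "0 < f y"
    using is_norm_on_nonneg[OF f y(1)] is_norm_on_eq_0[OF f y(1)] y(2) by fastforce
  show ?thesis
  proof
    show "0 \<le> 1 / f y"
      using pos by simp
    fix x assume x: "x \<in> S"
    show "norm x \<le> 1 / f y * f x"
    proof (cases "x = 0")
      case True
      then show ?thesis using is_norm_on_nonneg[OF f x] pos by simp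
    next
      case False
      have "f y \<le> f (x /\<^sub>R norm x)"
        using False subspace_scale[OF S x] by (intro min) auto
      also have "\<dots> = f x / norm x"
        by (simp add: is_norm_on_scale[OF f x] divide_inverse mult.commute)
      finally show ?thesis
        using False pos by (simp add: field_simps)
    qed
  qed
qed

text \<open>Pass from \<open>f\<close> to the Euclidean norm, apply Euclidean boundedness of
  \<open>L\<close>, and pass on to \<open>g\<close>. This supplies the finite bounds behind the
  suprema in \<open>block_norm\<close> and \<open>beta\<close>.\<close>

lemma linear_bounded_wrt_is_norm_on:
  fixes S :: "'a::euclidean_space set" and T :: "'b::euclidean_space set"
  assumes f: "is_norm_on S f" and S: "subspace S"
    and g: "is_norm_on T g" and T: "subspace T"
    and L: "linear L" and LT: "\<And>x. x \<in> S \<Longrightarrow> L x \<in> T"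
  shows "\<exists>M. \<forall>x\<in>S. g (L x) \<le> M * f x"
proof -
  obtain C where C: "0 \<le> C" "\<And>x. x \<in> T \<Longrightarrow> g x \<le> C * norm x"
    using is_norm_on_le_norm[OF g T] by metis
  obtain D where D: "0 \<le> D" "\<And>x. x \<in> S \<Longrightarrow> norm x \<le> D * f x"
    using norm_le_is_norm_on[OF f S] by metis
  obtain K where K: "0 < K" "\<And>x. norm (L x) \<le> K * norm x"
    using linear_bounded_pos[OF L] by metis
  have "g (L x) \<le> (C * K * D) * f x" if x: "x \<in> S" for x
  proof -
    have "g (L x) \<le> C * norm (L x)"
      using C(2) LT[OF x] .
    also have "\<dots> \<le> C * (K * norm x)"
      using K(2) C(1) by (rule mult_left_mono)
    also have "\<dots> \<le> C * (K * (D * f x))"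
      using D(2)[OF x] C(1) K(1) by (intro mult_left_mono) auto
    finally show ?thesis by (simp add: mult.assoc)
  qed
  then show ?thesis by blast
qed

text \<open>Normalising \<open>x\<close> to \<open>f\<close>-length 1 puts it in the ball over which
  the supremum is taken, and homogeneity restores the factor \<open>f x\<close>. The bound by
  \<open>M\<close> makes the supremum a genuine least upper bound. With
  \<open>S = vecs_on (V l)\<close> this serves the block norms, with \<open>S = UNIV\<close> it
  serves \<open>beta\<close>.\<close>

lemma homogeneous_le_SUP:
  fixes f g :: "'a::real_vector \<Rightarrow> real"
  assumes f: "is_norm_on S f" and S: "subspace S"
    and hom: "\<And>c x. 0 \<le> c \<Longrightarrow> x \<in> S \<Longrightarrow> g (c *\<^sub>R x) = c * g x"
    and bound: "\<And>x. x \<in> S \<Longrightarrow> g x \<le> M * f x"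
    and x: "x \<in> S"
  shows "g x \<le> (SUP u\<in>{u \<in> S. f u \<le> 1}. g u) * f x"
proof (cases "x = 0")
  case True
  then have "f x = 0"
    using is_norm_on_eq_0[OF f x] by simp
  then show ?thesis
    using bound[OF x] by simp
next
  case False
  then have pos: "0 < f x"
    using is_norm_on_nonneg[OF f x] is_norm_on_eq_0[OF f x] by simp
  have "bdd_above (g ` {u \<in> S. f u \<le> 1})"
  proof (intro bdd_aboveI2)
    fix u assume u: "u \<in> {u \<in> S. f u \<le> 1}"
    have "g u \<le> M * f u"
      using u bound by simp
    \<comment> \<open>The sign of \<open>M\<close> is not known, and for negative \<open>M\<close>
      the estimate \<open>M * f u\<close> \<le> \<open>M\<close> would fail when
      \<open>f u < 1\<close>; hence the absolute value.\<close>
    also have "\<dots> \<le> \<bar>M\<bar> * 1"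
      using u is_norm_on_nonneg[OF f] by (intro mult_mono) auto
    finally show "g u \<le> \<bar>M\<bar>" by simp
  qed
  moreover have "x /\<^sub>R f x \<in> {u \<in> S. f u \<le> 1}"
    using pos subspace_scale[OF S x] by (simp add: is_norm_on_scale[OF f x])
  ultimately have "g (x /\<^sub>R f x) \<le> (SUP u\<in>{u \<in> S. f u \<le> 1}. g u)"
    by (intro cSUP_upper)
  moreover have "g x = g (x /\<^sub>R f x) * f x"
    using pos hom[OF _ x, of "inverse (f x)"] by simp
  ultimately show ?thesis
    using pos by (simp add: mult_right_mono)
qed

section \<open>The seminorm \<open>pi_s\<close>\<close>

text \<open>This replaces the maximum by a statement about each feasible selection, and is the one
  place where \<open>pi_s_def\<close> is unfolded. It rests on the feasible set being finite and,
  thanks to \<open>0 \<le> s\<close>, containing 0.\<close>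

lemma pi_s_le_iff:
  fixes u :: "real^'k::finite"
  assumes "0 \<le> s"
  shows "pi_s wt s u \<le> c \<longleftrightarrow>
    (\<forall>\<eta>::real^'k. (\<forall>l. \<eta> $ l \<in> {0, 1}) \<and> (\<Sum>l\<in>UNIV. wt l * \<eta> $ l) \<le> s \<longrightarrow>
      2 * (\<Sum>l\<in>UNIV. \<eta> $ l * \<bar>u $ l\<bar>) \<le> c)"
proof -
  let ?F = "{\<eta>::real^'k. (\<forall>l. \<eta> $ l \<in> {0, 1}) \<and> (\<Sum>l\<in>UNIV. wt l * \<eta> $ l) \<le> s}"
  let ?g = "\<lambda>\<eta>::real^'k. \<Sum>l\<in>UNIV. \<eta> $ l * \<bar>u $ l\<bar>"
  have "finite {\<eta>::real^'k. \<forall>l. \<eta> $ l \<in> {0, 1}}"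
  proof (rule finite_surj)
    \<comment> \<open>A 0/1 vector is the indicator of its support, and a finite index type has
      finitely many subsets.\<close>
    show "{\<eta>::real^'k. \<forall>l. \<eta> $ l \<in> {0, 1}} \<subseteq> range (\<lambda>A. \<chi> l. if l \<in> A then 1 else 0)"
    proof
      fix \<eta> :: "real^'k"
      assume "\<eta> \<in> {\<eta>. \<forall>l. \<eta> $ l \<in> {0, 1}}"
      then have "\<eta> = (\<chi> l. if l \<in> {l. \<eta> $ l = 1} then 1 else 0)"
        by (auto simp: vec_eq_iff)
      then show "\<eta> \<in> range (\<lambda>A. \<chi> l. if l \<in> A then 1 else 0)"
        by blast
    qed
  qed simp
  then have fin: "finite (?g ` ?F)"
    by (intro finite_imageI) (auto elim: rev_finite_subset)
  have "0 \<in> ?F"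
    using assms by simp
  then have ne: "?g ` ?F \<noteq> {}" by blast
  have "pi_s wt s u = 2 * Max (?g ` ?F)"
    unfolding pi_s_def by (simp add: setcompr_eq_image)
  then have "pi_s wt s u \<le> c \<longleftrightarrow> Max (?g ` ?F) \<le> c / 2"
    by auto
  also have "\<dots> \<longleftrightarrow> (\<forall>\<eta>\<in>?F. ?g \<eta> \<le> c / 2)"
    unfolding Max_le_iff[OF fin ne] by blast
  finally show ?thesis
    by (simp add: mult.commute)
qed

lemma le_pi_s:
  assumes "0 \<le> s" "\<forall>l. \<eta> $ l \<in> {0, 1}" "(\<Sum>l\<in>UNIV. wt l * \<eta> $ l) \<le> s"
  shows "2 * (\<Sum>l\<in>UNIV. \<eta> $ l * \<bar>u $ l\<bar>) \<le> pi_s wt s u"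
  using iffD1[OF pi_s_le_iff[OF assms(1)] order_refl, rule_format, of \<eta> wt u] assms(2,3) by simp

lemma pi_s_mono:
  assumes "0 \<le> s" and "\<And>l. \<bar>u $ l\<bar> \<le> \<bar>v $ l\<bar>"
  shows "pi_s wt s u \<le> pi_s wt s v"
  unfolding pi_s_le_iff[OF assms(1)]
proof (intro allI impI)
  fix \<eta> :: "real^'a"
  assume \<eta>: "(\<forall>l. \<eta> $ l \<in> {0, 1}) \<and> (\<Sum>l\<in>UNIV. wt l * \<eta> $ l) \<le> s"
  then have "0 \<le> \<eta> $ l" for l
    by (cases "\<eta> $ l = 0") auto
  then have "2 * (\<Sum>l\<in>UNIV. \<eta> $ l * \<bar>u $ l\<bar>) \<le> 2 * (\<Sum>l\<in>UNIV. \<eta> $ l * \<bar>v $ l\<bar>)"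
    using assms(2) by (intro mult_left_mono sum_mono) auto
  also have "\<dots> \<le> pi_s wt s v"
    using \<eta> by (intro le_pi_s[OF assms(1)]) auto
  finally show "2 * (\<Sum>l\<in>UNIV. \<eta> $ l * \<bar>u $ l\<bar>) \<le> pi_s wt s v" .
qed

text \<open>Dropping the budget constraint leaves only that each \<open>\<eta> $ l\<close> is at
  most 1. This crude bound gives \<open>pi_s\<close> at 0 and the finiteness of the supremum in
  \<open>beta\<close>.\<close>

lemma pi_s_le_sum_abs:
  assumes "0 \<le> s"
  shows "pi_s wt s u \<le> 2 * (\<Sum>l\<in>UNIV. \<bar>u $ l\<bar>)"
  unfolding pi_s_le_iff[OF assms]
proof (intro allI impI mult_left_mono sum_mono)
  fix \<eta> :: "real^'a" and l
  assume "(\<forall>l. \<eta> $ l \<in> {0, 1}) \<and> (\<Sum>l\<in>UNIV. wt l * \<eta> $ l) \<le> s"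
  then show "\<eta> $ l * \<bar>u $ l\<bar> \<le> \<bar>u $ l\<bar>"
    by (cases "\<eta> $ l = 0") auto
qed simp

lemma pi_s_triangle:
  assumes "0 \<le> s"
  shows "pi_s wt s (u + v) \<le> pi_s wt s u + pi_s wt s v"
  unfolding pi_s_le_iff[OF assms, of _ "u + v"]
proof (intro allI impI)
  fix \<eta> :: "real^'a"
  assume \<eta>: "(\<forall>l. \<eta> $ l \<in> {0, 1}) \<and> (\<Sum>l\<in>UNIV. wt l * \<eta> $ l) \<le> s"
  then have "0 \<le> \<eta> $ l" for l
    by (cases "\<eta> $ l = 0") auto
  then have "2 * (\<Sum>l\<in>UNIV. \<eta> $ l * \<bar>(u + v) $ l\<bar>)
      \<le> 2 * (\<Sum>l\<in>UNIV. \<eta> $ l * (\<bar>u $ l\<bar> + \<bar>v $ l\<bar>))"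
    by (intro mult_left_mono sum_mono) (auto simp: abs_triangle_ineq)
  also have "\<dots> = 2 * (\<Sum>l\<in>UNIV. \<eta> $ l * \<bar>u $ l\<bar>) + 2 * (\<Sum>l\<in>UNIV. \<eta> $ l * \<bar>v $ l\<bar>)"
    by (simp add: distrib_left sum.distrib)
  also have "\<dots> \<le> pi_s wt s u + pi_s wt s v"
    using \<eta> by (intro add_mono le_pi_s[OF assms]) auto
  finally show "2 * (\<Sum>l\<in>UNIV. \<eta> $ l * \<bar>(u + v) $ l\<bar>) \<le> pi_s wt s u + pi_s wt s v" .
qed

lemma pi_s_zero:
  assumes "0 \<le> s"
  shows "pi_s wt s 0 = 0"
proof (rule antisym)
  show "pi_s wt s 0 \<le> 0"
    using pi_s_le_sum_abs[OF assms, of wt 0] by simp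
  show "0 \<le> pi_s wt s 0"
    using le_pi_s[OF assms, of 0 wt 0] assms by simp
qed

lemma pi_s_scale_le:
  assumes "0 \<le> s" and "0 \<le> c"
  shows "pi_s wt s (c *\<^sub>R u) \<le> c * pi_s wt s u"
  unfolding pi_s_le_iff[OF assms(1), of _ "c *\<^sub>R u"]
proof (intro allI impI)
  fix \<eta> :: "real^'a"
  assume \<eta>: "(\<forall>l. \<eta> $ l \<in> {0, 1}) \<and> (\<Sum>l\<in>UNIV. wt l * \<eta> $ l) \<le> s"
  have "2 * (\<Sum>l\<in>UNIV. \<eta> $ l * \<bar>(c *\<^sub>R u) $ l\<bar>) = c * (2 * (\<Sum>l\<in>UNIV. \<eta> $ l * \<bar>u $ l\<bar>))"
    using assms(2) by (simp add: abs_mult sum_distrib_left mult_ac)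
  also have "\<dots> \<le> c * pi_s wt s u"
    using \<eta> by (intro mult_left_mono[OF _ assms(2)] le_pi_s[OF assms(1)]) auto
  finally show "2 * (\<Sum>l\<in>UNIV. \<eta> $ l * \<bar>(c *\<^sub>R u) $ l\<bar>) \<le> c * pi_s wt s u" .
qed

lemma pi_s_scale:
  assumes "0 \<le> s" and "0 \<le> c"
  shows "pi_s wt s (c *\<^sub>R u) = c * pi_s wt s u"
proof (cases "c = 0")
  case True
  then show ?thesis by (simp add: pi_s_zero[OF assms(1)])
next
  case False
  \<comment> \<open>The reverse inequality is the scaling inequality itself, applied to the vector
    \<open>c *\<^sub>R u\<close> with factor \<open>inverse c\<close>.\<close>
  have "pi_s wt s (inverse c *\<^sub>R (c *\<^sub>R u)) \<le> inverse c * pi_s wt s (c *\<^sub>R u)"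
    using assms by (intro pi_s_scale_le) auto
  with False assms(2) have "c * pi_s wt s u \<le> pi_s wt s (c *\<^sub>R u)"
    by (simp add: field_simps)
  with pi_s_scale_le[OF assms] show ?thesis
    by (intro antisym)
qed

lemma pi_s_sum:
  assumes "0 \<le> s" and "finite I"
  shows "pi_s wt s (\<Sum>i\<in>I. u i) \<le> (\<Sum>i\<in>I. pi_s wt s (u i))"
  using assms(2)
proof (induction I rule: finite_induct)
  case (insert i I)
  have "pi_s wt s (u i + (\<Sum>j\<in>I. u j)) \<le> pi_s wt s (u i) + pi_s wt s (\<Sum>j\<in>I. u j)"
    by (rule pi_s_triangle[OF assms(1)])
  also have "\<dots> \<le> pi_s wt s (u i) + (\<Sum>j\<in>I. pi_s wt s (u j))"
    using insert.IH by (rule add_left_mono)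
  finally show ?case
    using insert.hyps by simp
qed (simp add: pi_s_zero[OF assms(1)])

section \<open>The group decomposition\<close>

lemma subspace_vecs_on: "subspace (vecs_on U)"
  by (auto simp: subspace_def vecs_on_def)

text \<open>Each \<open>nrm l\<close> is a norm only on \<open>vecs_on (V l)\<close>, so this
  membership is a side condition whenever a norm axiom is applied to a component.\<close>

lemma comp_of_in_vecs_on: "comp_of e V l w \<in> vecs_on (V l)"
  by (simp add: comp_of_def vecs_on_def)

lemma linear_comp_of: "linear (comp_of e V l)"
  by (rule linearI) (auto simp: comp_of_def vec_eq_iff)

lemma block_mult_in_vecs_on: "block e V W k l *v u \<in> vecs_on (V k)"
  by (simp add: block_def vecs_on_def matrix_vector_mult_def)

lemma norm_1s_triangle:
  assumes nrm: "\<And>l. is_norm_on (vecs_on (V l)) (nrm l)" and s: "0 \<le> s"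
  shows "norm_1s e V nrm wt s (v + w) \<le> norm_1s e V nrm wt s v + norm_1s e V nrm wt s w"
proof -
  have nonneg: "0 \<le> nrm l (comp_of e V l x)" for l x
    by (intro is_norm_on_nonneg[OF nrm] comp_of_in_vecs_on)
  \<comment> \<open>\<open>group_norms\<close> is only subadditive in each entry, so monotonicity of
    \<open>pi_s\<close> comes before its triangle inequality.\<close>
  have "pi_s wt s (group_norms e V nrm (v + w))
      \<le> pi_s wt s (group_norms e V nrm v + group_norms e V nrm w)"
  proof (rule pi_s_mono[OF s])
    fix l
    have "nrm l (comp_of e V l (v + w)) \<le> nrm l (comp_of e V l v) + nrm l (comp_of e V l w)"
      unfolding linear_add[OF linear_comp_of]
      by (intro is_norm_on_triangle[OF nrm] comp_of_in_vecs_on)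
    then show "\<bar>group_norms e V nrm (v + w) $ l\<bar>
        \<le> \<bar>(group_norms e V nrm v + group_norms e V nrm w) $ l\<bar>"
      by (simp add: group_norms_def nonneg add_nonneg_nonneg)
  qed
  also have "\<dots> \<le> pi_s wt s (group_norms e V nrm v) + pi_s wt s (group_norms e V nrm w)"
    by (rule pi_s_triangle[OF s])
  finally show ?thesis
    by (simp add: norm_1s_def)
qed

lemma norm_1s_scale:
  assumes nrm: "\<And>l. is_norm_on (vecs_on (V l)) (nrm l)" and "0 \<le> s" and "0 \<le> c"
  shows "norm_1s e V nrm wt s (c *\<^sub>R w) = c * norm_1s e V nrm wt s w"
proof -
  have "group_norms e V nrm (c *\<^sub>R w) = c *\<^sub>R group_norms e V nrm w"
    using \<open>0 \<le> c\<close>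
    by (simp add: vec_eq_iff group_norms_def linear_scale[OF linear_comp_of]
        is_norm_on_scale[OF nrm] comp_of_in_vecs_on)
  then show ?thesis
    using assms(2,3) by (simp add: norm_1s_def pi_s_scale)
qed

text \<open>The map sending \<open>v\<close> to \<open>norm_1s\<close> of
  \<open>transpose H *v v\<close> is positively homogeneous, so \<open>homogeneous_le_SUP\<close>
  applies once it is bounded by a multiple of \<open>\<phi>\<close>. Such a bound comes from one
  constant \<open>M l\<close> per group, added up over the groups.\<close>

lemma norm_1s_le_beta:
  fixes H :: "real^'p::finite^'m::finite"
  assumes nrm: "\<And>l. is_norm_on (vecs_on (V l)) (nrm l)" and \<phi>: "is_norm_on UNIV \<phi>" and s: "0 \<le> s"
  shows "norm_1s e V nrm wt s (transpose H *v v) \<le> beta e V nrm wt s \<phi> H * \<phi> v"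
proof -
  have "\<exists>M. \<forall>v. nrm l (comp_of e V l (transpose H *v v)) \<le> M * \<phi> v" for l
  proof -
    have "linear (\<lambda>v. comp_of e V l (transpose H *v v))"
      by (rule linear_compose[OF matrix_vector_mul_linear linear_comp_of, unfolded o_def])
    from linear_bounded_wrt_is_norm_on[OF \<phi> subspace_UNIV nrm[of l] subspace_vecs_on this
        comp_of_in_vecs_on]
    show ?thesis
      by simp
  qed
  then obtain M where M: "\<And>l v. nrm l (comp_of e V l (transpose H *v v)) \<le> M l * \<phi> v"
    using choice[of "\<lambda>l M. \<forall>v. nrm l (comp_of e V l (transpose H *v v)) \<le> M * \<phi> v"] by blast
  have "norm_1s e V nrm wt s (transpose H *v v) \<le> (2 * (\<Sum>l\<in>UNIV. M l)) * \<phi> v" for v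
  proof -
    have "norm_1s e V nrm wt s (transpose H *v v)
        \<le> 2 * (\<Sum>l\<in>UNIV. nrm l (comp_of e V l (transpose H *v v)))"
      using pi_s_le_sum_abs[OF s, of wt "group_norms e V nrm (transpose H *v v)"]
      by (simp add: norm_1s_def group_norms_def is_norm_on_nonneg[OF nrm] comp_of_in_vecs_on)
    also have "\<dots> \<le> 2 * (\<Sum>l\<in>UNIV. M l * \<phi> v)"
      using M by (intro mult_left_mono sum_mono) auto
    finally show ?thesis by (simp only: sum_distrib_right mult.assoc)
  qed
  moreover have "norm_1s e V nrm wt s (transpose H *v (c *\<^sub>R v))
      = c * norm_1s e V nrm wt s (transpose H *v v)" if "0 \<le> c" for c v
    unfolding matrix_vector_mult_scaleR using that
    by (intro norm_1s_scale[where nrm = nrm, OF nrm s])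
  ultimately have "norm_1s e V nrm wt s (transpose H *v v)
      \<le> (SUP v\<in>{v \<in> UNIV. \<phi> v \<le> 1}. norm_1s e V nrm wt s (transpose H *v v)) * \<phi> v"
    by (intro homogeneous_le_SUP[OF \<phi> subspace_UNIV]) auto
  then show ?thesis
    by (simp add: beta_def)
qed

text \<open>Entry \<open>(k, l)\<close> of \<open>Omega\<close> is an operator norm from the space
  of group \<open>l\<close> to that of group \<open>k\<close>; boundedness of the block makes its
  supremum usable.\<close>

lemma norm_block_mult_le_Omega:
  assumes nrm: "\<And>l. is_norm_on (vecs_on (V l)) (nrm l)" and u: "u \<in> vecs_on (V l)"
  shows "nrm k (block e V W k l *v u) \<le> Omega e V nrm W $ k $ l * nrm l u"
proof -
  let ?Q = "block e V W k l"
  obtain M where M: "\<And>u. u \<in> vecs_on (V l) \<Longrightarrow> nrm k (?Q *v u) \<le> M * nrm l u"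
    using linear_bounded_wrt_is_norm_on[OF nrm[of l] subspace_vecs_on nrm[of k] subspace_vecs_on
        matrix_vector_mul_linear[of ?Q] block_mult_in_vecs_on]
    by blast
  have "nrm k (?Q *v (c *\<^sub>R u)) = c * nrm k (?Q *v u)" if "0 \<le> c" for c u
    using that
    by (simp add: matrix_vector_mult_scaleR is_norm_on_scale[OF nrm] block_mult_in_vecs_on)
  from homogeneous_le_SUP[OF nrm[of l] subspace_vecs_on this M u] show ?thesis
    by (simp add: Omega_def block_norm_def)
qed

lemma norm_1s_mult_le:
  fixes V :: "'k::finite \<Rightarrow> 'n::finite set" and W :: "real^'p::finite^'p"
  assumes nrm: "\<And>l. is_norm_on (vecs_on (V l)) (nrm l)" and s: "0 \<le> s"
    and e: "bij_betw e UNIV (SIGMA l:UNIV. V l)"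
    and col: "\<And>l. pi_s wt s (column l (Omega e V nrm W)) \<le> \<gamma>"
  shows "norm_1s e V nrm wt s (W *v w) \<le> \<gamma> * E_norm e V nrm w"
proof -
  let ?t = "\<lambda>l. nrm l (comp_of e V l w)"
  let ?C = "\<lambda>l. column l (Omega e V nrm W)"
  have nonneg: "0 \<le> nrm l (comp_of e V l x)" for l x
    by (intro is_norm_on_nonneg[OF nrm] comp_of_in_vecs_on)
  \<comment> \<open>The dominating vector is written as a combination of columns because
    \<open>col\<close> bounds \<open>pi_s\<close> column by column.\<close>
  have "pi_s wt s (group_norms e V nrm (W *v w)) \<le> pi_s wt s (\<Sum>l\<in>UNIV. ?t l *\<^sub>R ?C l)"
  proof (rule pi_s_mono[OF s])
    fix k
    have "nrm k (comp_of e V k (W *v w)) \<le> (\<Sum>l\<in>UNIV. nrm k (block e V W k l *v comp_of e V l w))"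
      unfolding comp_of_mult[OF e]
      by (intro is_norm_on_sum[OF nrm subspace_vecs_on] block_mult_in_vecs_on) simp
    also have "\<dots> \<le> (\<Sum>l\<in>UNIV. Omega e V nrm W $ k $ l * ?t l)"
      by (intro sum_mono norm_block_mult_le_Omega[where nrm = nrm, OF nrm] comp_of_in_vecs_on)
    also have "\<dots> = (\<Sum>l\<in>UNIV. ?t l *\<^sub>R ?C l) $ k"
      by (simp add: column_def mult.commute)
    \<comment> \<open>The left entry is nonnegative, and the right one is at most its absolute
      value.\<close>
    finally show "\<bar>group_norms e V nrm (W *v w) $ k\<bar> \<le> \<bar>(\<Sum>l\<in>UNIV. ?t l *\<^sub>R ?C l) $ k\<bar>"
      using nonneg[of k "W *v w"] by (simp add: group_norms_def)
  qed
  also have "\<dots> \<le> (\<Sum>l\<in>UNIV. pi_s wt s (?t l *\<^sub>R ?C l))"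
    by (rule pi_s_sum[OF s]) simp
  \<comment> \<open>The coefficients \<open>?t l\<close> are nonnegative, so they come out of
    \<open>pi_s\<close>; they add up to \<open>E_norm e V nrm w\<close>.\<close>
  also have "\<dots> = (\<Sum>l\<in>UNIV. ?t l * pi_s wt s (?C l))"
    by (intro sum.cong refl pi_s_scale[OF s] nonneg)
  also have "\<dots> \<le> (\<Sum>l\<in>UNIV. ?t l * \<gamma>)"
    by (intro sum_mono mult_left_mono col nonneg)
  finally show ?thesis
    by (simp add: norm_1s_def E_norm_def sum_distrib_left mult.commute)
qed

theorem proposition4p2:
  fixes V :: "'k::finite \<Rightarrow> 'n::finite set"
    and wt :: "'k \<Rightarrow> real"
    and nrm :: "'k \<Rightarrow> real^'n \<Rightarrow> real"
    and e :: "'p::finite \<Rightarrow> 'k \<times> 'n"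
    and A :: "real^'n^'m::finite"
    and \<phi> :: "real^'m \<Rightarrow> real"
    and s \<gamma> :: real
    and H :: "real^'p^'m"
    and W :: "real^'p^'p"
  assumes "\<And>l. V l \<noteq> {}"
    and "(\<Union>l. V l) = UNIV"
    and "\<And>l. 0 < wt l"
    and "\<And>l. is_norm_on (vecs_on (V l)) (nrm l)"
    and "bij_betw e UNIV (SIGMA l:UNIV. V l)"
    and "is_norm_on UNIV \<phi>"
    and "0 < s"
    and "0 < \<gamma>"
    and "matrix (B_map e V) = W ** matrix (B_map e V) + transpose H ** A"
    and "(MAX l. pi_s wt s (column l (Omega e V nrm W))) \<le> \<gamma>"
  shows "\<forall>z. norm_1s e V nrm wt s (B_map e V z)
           \<le> beta e V nrm wt s \<phi> H * \<phi> (A *v z) + \<gamma> * E_norm e V nrm (B_map e V z)"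
proof
  fix z
  let ?w = "B_map e V z"
  note nrm = assms(4)
  have s: "0 \<le> s"
    using assms(7) by simp
  have col: "pi_s wt s (column l (Omega e V nrm W)) \<le> \<gamma>" for l
    using assms(10) by (subst (asm) Max_le_iff) auto
  have "?w = matrix (B_map e V) *v z"
    by (simp add: matrix_works linear_B_map)
  \<comment> \<open>Relation (a) contains \<open>B\<close> on both sides; it is used once, on the
    left occurrence, and evaluated at \<open>z\<close>.\<close>
  also have "\<dots> = W *v (matrix (B_map e V) *v z) + transpose H *v (A *v z)"
    by (subst assms(9)) (simp add: matrix_vector_mult_add_rdistrib matrix_vector_mul_assoc)
  \<comment> \<open>This rewrites the argument of \<open>W\<close>, so that
    \<open>norm_1s_mult_le\<close> can be applied to \<open>?w\<close>.\<close>
  also have "matrix (B_map e V) *v z = ?w"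
    by (simp add: matrix_works linear_B_map)
  finally have "norm_1s e V nrm wt s ?w
      = norm_1s e V nrm wt s (W *v ?w + transpose H *v (A *v z))"
    by (rule arg_cong)
  also have "\<dots> \<le> norm_1s e V nrm wt s (W *v ?w)
      + norm_1s e V nrm wt s (transpose H *v (A *v z))"
    by (rule norm_1s_triangle[where nrm = nrm, OF nrm s])
  also have "\<dots> \<le> \<gamma> * E_norm e V nrm ?w + beta e V nrm wt s \<phi> H * \<phi> (A *v z)"
    by (intro add_mono norm_1s_mult_le norm_1s_le_beta nrm s col assms(5,6))
  finally show "norm_1s e V nrm wt s ?w
      \<le> beta e V nrm wt s \<phi> H * \<phi> (A *v z) + \<gamma> * E_norm e V nrm ?w"
    by simp
qed

end
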